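(* Let $\mathbf{A}\in\mathbb{R}^{n\times n}$ be Hurwitz, $\mathbf{B}\in\mathbb{R}^{n\times m}$, $\mathbf{C}\in\mathbb{R}^{p\times n}$, $\mathbf{B}_{\mathcal X}\in\mathbb{R}^{n\times m_x}$, $\mathbf{C}_{\mathcal Y}\in\mathbb{R}^{p_y\times n}$. Define the transfer functions $$\mathbf{G}_{\sigma,\mathbf{A}}(s):=\mathbf{C}_{\mathcal Y}(s\mathbf{I}_n-\mathbf{A})^{-1}\mathbf{B}_{\mathcal X}\in\mathbb{C}^{p_y\times m_x},$$ $$\mathbf{G}_{\mathbf{B}}(s):=\mathbf{C}_{\mathcal Y}(s\mathbf{I}_n-\mathbf{A})^{-1}\mathbf{B}\in\mathbb{C}^{p_y\times m},\qquad \mathbf{G}_{\mathbf{C}}(s):=\mathbf{C}(s\mathbf{I}_n-\mathbf{A})^{-1}\mathbf{B}_{\mathcal X}\in\mathbb{C}^{p\times m_x}.$$ Let $\rho_j,\zeta_j\in\mathbb{R}$ ($j=1,\dots,J$) and $\phi_k,\omega_k\in\mathbb{R}$ ($k=1,\dots,K$), with $\omega_k\neq\zeta_j$ for all $k,j$. Let $\widetilde{\mathbf{U}}_{\mathcal X}\in\mathbb{C}^{n\times(m_xJ)}$ be the matrix whose $j$-th column block (of size $n\times m_x$) is $$\big(\widetilde{\mathbf{U}}_{\mathcal X}\big)_j=\rho_j(\dot{\imath}\zeta_j\mathbf{I}_n-\mathbf{A})^{-1}\mathbf{B}_{\mathcal X},\qquad j=1,\dots,J,$$ and let $\widetilde{\mathbf{L}}_{\mathcal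 Y}\in\mathbb{C}^{n\times(p_yK)}$ be the matrix for which the $k$-th row block (of size $p_y\times n$) of $\widetilde{\mathbf{L}}_{\mathcal Y}^{\mathsf H}$ is $$\big(\widetilde{\mathbf{L}}_{\mathcal Y}^{\mathsf H}\big)_k=\phi_k\mathbf{C}_{\mathcal Y}(\dot{\imath}\omega_k\mathbf{I}_n-\mathbf{A})^{-1},\qquad k=1,\dots,K.$$ Define $$\widetilde{\mathbb{L}}:=\widetilde{\mathbf{L}}_{\mathcal Y}^{\mathsf H}\widetilde{\mathbf{U}}_{\mathcal X}\in\mathbb{C}^{(p_yK)\times(m_xJ)},\quad \widetilde{\mathbb{M}}:=\widetilde{\mathbf{L}}_{\mathcal Y}^{\mathsf H}\mathbf{A}\widetilde{\mathbf{U}}_{\mathcal X}\in\mathbb{C}^{(p_yK)\times(m_xJ)},$$ $$\widetilde{\mathbb{H}}:=\widetilde{\mathbf{L}}_{\mathcal Y}^{\mathsf H}\mathbf{B}\in\mathbb{C}^{(p_yK)\times m},\quad \widetilde{\mathbb{G}}:=\mathbf{C}\widetilde{\mathbf{U}}_{\mathcal X}\in\mathbb{C}^{p\times(m_xJ)}.$$ Then for each $1\le k\le K$ and $1\le j\le J$, the $(k,j)$-th blocks (of size $p_y\times m_x$) of $\widetilde{\mathbb{L}}$ and $\widetilde{\mathbb{M}}$ are $$\widetilde{\mathbb{L}}_{k,j}=-\phi_k\rho_j\frac{\mathbf{G}_{\sigma,\mathbf{A}}(\dot{\imath}\omega_k)-\mathbf{G}_{\sigma,\mathbf{A}}(\dot{\imath}\zeta_j)}{\dot{\imath}\omega_k-\dot{\imath}\zeta_j},$$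 $$\widetilde{\mathbb{M}}_{k,j}=-\phi_k\rho_j\frac{\dot{\imath}\omega_k\mathbf{G}_{\sigma,\mathbf{A}}(\dot{\imath}\omega_k)-\dot{\imath}\zeta_j\mathbf{G}_{\sigma,\mathbf{A}}(\dot{\imath}\zeta_j)}{\dot{\imath}\omega_k-\dot{\imath}\zeta_j},$$ and the $k$-th row block (of size $p_y\times m$) of $\widetilde{\mathbb{H}}$ and the $j$-th column block (of size $p\times m_x$) of $\widetilde{\mathbb{G}}$ are $$\widetilde{\mathbb{H}}_k=\phi_k\mathbf{G}_{\mathbf{B}}(\dot{\imath}\omega_k)\qquad\text{and}\qquad \widetilde{\mathbb{G}}_j=\rho_j\mathbf{G}_{\mathbf{C}}(\dot{\imath}\zeta_j).$$
   Context: $\dot{\imath}$ is the imaginary unit, $\mathbf{I}_n$ the $n\times n$ identity, and $(\cdot)^{\mathsf H}$ the conjugate transpose. A matrix is Hurwitz if all its eigenvalues lie in the open left half-plane. Block notation: for a matrix partitioned into equally sized blocks, $\mathbf{M}_{k,j}$ denotes the $(k,j)$-th block; if there is only one block row or one block column, $\mathbf{M}_i$ denotes the $i$-th block. Setting: $\mathbf{A},\mathbf{B},\mathbf{C}$ come from a minimal (reachable and observable), asymptotically stable linear time-invariant system $\dot{\mathbf x}=\mathbf{A}\mathbf{x}+\mathbf{B}\mathbf{u}$, $\mathbf{y}=\mathbf{C}\mathbf{x}+\mathbf{D}\mathbf{u}$. The matrices $\mathbf{B}_{\mathcal X}$ and $\mathbf{C}_{\mathcal Y}$ are the input and output matrices,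 respectively, of two further minimal linear systems $\mathcal{X}=(\mathbf{A},\mathbf{B}_{\mathcal X},\mathbf{C}_{\mathcal X},\mathbf{D}_{\mathcal X})$ and $\mathcal{Y}=(\mathbf{A},\mathbf{B}_{\mathcal Y},\mathbf{C}_{\mathcal Y},\mathbf{D}_{\mathcal Y})$ sharing the same state matrix $\mathbf{A}$. The numbers $\rho_j^2,\zeta_j$ and $\phi_k^2,\omega_k$ are weights and nodes of two numerical quadrature rules on the imaginary axis. *)

theory Defs
  imports "Jordan_Normal_Form.Schur_Decomposition" "Jordan_Normal_Form.Gauss_Jordan_Elimination"
begin

abbreviation cmat :: "real mat \<Rightarrow> complex mat" where
  "cmat \<equiv> map_mat complex_of_real"

text \<open>Eigenvalues of a real matrix are taken over the complex numbers.\<close>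

definition hurwitz :: "real mat \<Rightarrow> bool" where
  "hurwitz A \<longleftrightarrow> (\<forall>z. eigenvalue (cmat A) z \<longrightarrow> Re z < 0)"

text \<open>The function \<^const>\<open>mat_inverse\<close> returns \<^const>\<open>None\<close> on singular matrices, so the value
  of the resolvent is meaningful only if \<open>s\<close> is not an eigenvalue of \<open>A\<close>.\<close>

definition resolvent :: "real mat \<Rightarrow> complex \<Rightarrow> complex mat" where
  "resolvent A s = the (mat_inverse (s \<cdot>\<^sub>m 1\<^sub>m (dim_row A) - cmat A))"

definition transfer_fun :: "real mat \<Rightarrow> real mat \<Rightarrow> real mat \<Rightarrow> complex \<Rightarrow> complex mat" where
  "transfer_fun A B C s = cmat C * resolvent A s * cmat B"

text \<open>Matrices partitioned into blocks of size \<open>r \<times> c\<close>. Block indices start at 0, like the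
  entry indices of \<^typ>\<open>'a mat\<close>.\<close>

definition mat_block :: "nat \<Rightarrow> nat \<Rightarrow> 'a mat \<Rightarrow> nat \<Rightarrow> nat \<Rightarrow> 'a mat" where
  "mat_block r c M k j = mat r c (\<lambda>(a, b). M $$ (k * r + a, j * c + b))"

definition row_block :: "nat \<Rightarrow> 'a mat \<Rightarrow> nat \<Rightarrow> 'a mat" where
  "row_block r M k = mat_block r (dim_col M) M k 0"

definition col_block :: "nat \<Rightarrow> 'a mat \<Rightarrow> nat \<Rightarrow> 'a mat" where
  "col_block c M j = mat_block (dim_row M) c M 0 j"

end

theory Submission
  imports Defs
begin

text \<open>
  A block of a product of partitioned matrices is a block row of the left factor times a block
  column of the right one. Weights are scalars and can be pulled out of products, so every claim
  concerns one row block \<open>L = C\<^sub>Y (s I - A)\<^sup>-\<^sup>1\<close> and one column block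
  \<open>U = (t I - A)\<^sup>-\<^sup>1 B\<^sub>X\<close>, where \<open>s = \<i> \<omega>\<close> and \<open>t = \<i> \<zeta>\<close>. The resolvents exist because the
  spectrum of a Hurwitz matrix does not meet the imaginary axis. The products \<open>L B\<close> and \<open>C U\<close>
  are transfer functions by definition.

  For \<open>L U\<close> and \<open>L A U\<close>, multiplying the resolvent by \<open>A\<close> gives the two relations
  \<open>L A = s L - C\<^sub>Y\<close> and \<open>A U = t U - B\<^sub>X\<close>. Evaluating \<open>L A U\<close> with either of them yields
  \<open>L A U = s (L U) - C\<^sub>Y U = t (L U) - L B\<^sub>X\<close>, in which \<open>L B\<^sub>X\<close> and \<open>C\<^sub>Y U\<close> are the values of the
  transfer function at \<open>s\<close> and \<open>t\<close>. For \<open>s \<noteq> t\<close> these two linear equations determine \<open>L U\<close> and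
  \<open>L A U\<close>, and their solutions are the two divided differences (lemma \<open>loewner_solution\<close>).
\<close>

section \<open>Blocks of matrix products\<close>

text \<open>Entry access outside the dimensions of a matrix yields an unspecified value, so the entry
  formula of a product applies to a block only once its indices are known to be in range.\<close>

lemma block_index_less:
  fixes a k r K :: nat
  assumes "k < K" "a < r"
  shows "k * r + a < r * K"
proof -
  have "k * r + a < (k + 1) * r"
    using assms(2) by simp
  also have "\<dots> \<le> K * r"
    using assms(1) by (intro mult_right_mono) auto
  finally show ?thesis
    by (simp add: mult.commute)
qed

lemma mat_block_mult:
  fixes M N :: "'a :: comm_semiring_0 mat"
  assumes "M \<in> carrier_mat (r * K) n" "N \<in> carrier_mat n (c * J)" "k < K" "j < J"
  shows "mat_block r c (M * N) k j = row_block r M k * col_block c N j"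
  using assms block_index_less[OF assms(3)] block_index_less[OF assms(4)]
  by (intro eq_matI)
    (auto simp: mat_block_def row_block_def col_block_def scalar_prod_def intro!: sum.cong)

lemma row_block_mult:
  fixes M N :: "'a :: comm_semiring_0 mat"
  assumes "M \<in> carrier_mat (r * K) n" "N \<in> carrier_mat n m" "k < K"
  shows "row_block r (M * N) k = row_block r M k * N"
  using assms block_index_less[OF assms(3)]
  by (intro eq_matI)
    (auto simp: mat_block_def row_block_def scalar_prod_def intro!: sum.cong)

lemma col_block_mult:
  fixes M N :: "'a :: comm_semiring_0 mat"
  assumes "M \<in> carrier_mat p n" "N \<in> carrier_mat n (c * J)" "j < J"
  shows "col_block c (M * N) j = M * col_block c N j"
  using assms block_index_less[OF assms(3)]
  by (intro eq_matI)
    (auto simp: mat_block_def col_block_def scalar_prod_def intro!: sum.cong)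

section \<open>The resolvent\<close>

lemma smult_smult_mat:
  fixes X :: "'a :: semigroup_mult mat"
  shows "a \<cdot>\<^sub>m (b \<cdot>\<^sub>m X) = (a * b) \<cdot>\<^sub>m X"
  by (intro eq_matI) (auto simp: mult.assoc)

lemma smult_minus_mult:
  fixes X Y Z :: "'a :: comm_ring mat"
  assumes "X \<in> carrier_mat p n" "Y \<in> carrier_mat p n" "Z \<in> carrier_mat n m"
  shows "(a \<cdot>\<^sub>m X - Y) * Z = a \<cdot>\<^sub>m (X * Z) - Y * Z"
  unfolding minus_mult_distrib_mat[OF smult_carrier_mat[OF assms(1)] assms(2,3)]
    mult_smult_assoc_mat[OF assms(1,3)] ..

lemma mult_smult_minus:
  fixes X Y Z :: "'a :: comm_ring mat"
  assumes "Z \<in> carrier_mat p n" "X \<in> carrier_mat n m" "Y \<in> carrier_mat n m"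
  shows "Z * (a \<cdot>\<^sub>m X - Y) = a \<cdot>\<^sub>m (Z * X) - Z * Y"
  unfolding mult_minus_distrib_mat[OF assms(1) smult_carrier_mat[OF assms(2)] assms(3)]
    mult_smult_distrib[OF assms(1,2)] ..

text \<open>The matrix \<open>s I - A\<close> is the negative of the characteristic matrix, whose determinant vanishes
  exactly at the eigenvalues. So away from the spectrum the computed inverse exists and is
  two-sided.\<close>

lemma resolvent_inverts:
  assumes A: "A \<in> carrier_mat n n" and s: "\<not> eigenvalue (cmat A) s"
  shows "resolvent A s \<in> carrier_mat n n"
    and "(s \<cdot>\<^sub>m 1\<^sub>m n - cmat A) * resolvent A s = 1\<^sub>m n"
    and "resolvent A s * (s \<cdot>\<^sub>m 1\<^sub>m n - cmat A) = 1\<^sub>m n"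
proof -
  let ?Q = "s \<cdot>\<^sub>m 1\<^sub>m n - cmat A"
  have cA: "cmat A \<in> carrier_mat n n" and Q: "?Q \<in> carrier_mat n n"
    using A by auto
  have neg: "- char_matrix (cmat A) s = ?Q"
    using A by (intro eq_matI) (auto simp: char_matrix_def)
  have "det (char_matrix (cmat A) s) \<noteq> 0"
    using s eigenvalue_det[OF cA] by simp
  then have "det ?Q \<noteq> 0"
    using det_0_negate[of "char_matrix (cmat A) s" n] cA neg by auto
  then have "mat_inverse ?Q \<noteq> None"
    using det_non_zero_imp_unit[OF Q, where b = "()"] mat_inverse(1)[OF Q, where b = "()"] by blast
  then obtain R where R: "mat_inverse ?Q = Some R"
    by blast
  then have "resolvent A s = R"
    using A by (simp add: resolvent_def)
  then show "resolvent A s \<in> carrier_mat n n" "?Q * resolvent A s = 1\<^sub>m n"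
    "resolvent A s * ?Q = 1\<^sub>m n"
    using mat_inverse(2)[OF Q R] by auto
qed

lemma hurwitz_imaginary_not_eigenvalue:
  assumes "hurwitz A"
  shows "\<not> eigenvalue (cmat A) (\<i> * complex_of_real w)"
  using assms by (force simp: hurwitz_def)

lemma state_mult_resolvent:
  assumes A: "A \<in> carrier_mat n n" and s: "\<not> eigenvalue (cmat A) s"
  shows "cmat A * resolvent A s = s \<cdot>\<^sub>m resolvent A s - 1\<^sub>m n"
    and "resolvent A s * cmat A = s \<cdot>\<^sub>m resolvent A s - 1\<^sub>m n"
proof -
  note R = resolvent_inverts[OF A s]
  have cA: "cmat A \<in> carrier_mat n n"
    using A by simp
  have "(s \<cdot>\<^sub>m 1\<^sub>m n - cmat A) * resolvent A s = s \<cdot>\<^sub>m resolvent A s - cmat A * resolvent A s"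
    using R(1) smult_minus_mult[OF one_carrier_mat cA R(1)] by simp
  then have eq: "s \<cdot>\<^sub>m resolvent A s - cmat A * resolvent A s = 1\<^sub>m n"
    using R(2) by simp
  show "cmat A * resolvent A s = s \<cdot>\<^sub>m resolvent A s - 1\<^sub>m n"
    unfolding eq[symmetric] using R(1) A by (intro eq_matI) auto
  have "resolvent A s * (s \<cdot>\<^sub>m 1\<^sub>m n - cmat A) = s \<cdot>\<^sub>m resolvent A s - resolvent A s * cmat A"
    using R(1) mult_smult_minus[OF R(1) one_carrier_mat cA] by simp
  then have eq: "s \<cdot>\<^sub>m resolvent A s - resolvent A s * cmat A = 1\<^sub>m n"
    using R(3) by simp
  show "resolvent A s * cmat A = s \<cdot>\<^sub>m resolvent A s - 1\<^sub>m n"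
    unfolding eq[symmetric] using R(1) A by (intro eq_matI) auto
qed

section \<open>Divided differences of the transfer function\<close>

lemma linear_system_solution:
  fixes s t x y b c :: "'a :: field"
  assumes st: "s \<noteq> t" and y: "y = s * x - c" "y = t * x - b"
  shows "x = - 1 / (s - t) * (b - c)" and "y = - 1 / (s - t) * (s * b - t * c)"
proof -
  have x: "(s - t) * x = - (b - c)"
    using y by (simp add: algebra_simps)
  have "(s - t) * y = s * ((s - t) * x) - (s - t) * c"
    unfolding y(1) by (simp add: algebra_simps)
  also have "\<dots> = - (s * b - t * c)"
    unfolding x by (simp add: algebra_simps)
  finally have y': "(s - t) * y = - (s * b - t * c)" .
  have solve: "z = - 1 / (s - t) * d" if "(s - t) * z = - d" for z d
  proof -
    have "z = (s - t) * z / (s - t)"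
      using st by simp
    also have "\<dots> = - 1 / (s - t) * d"
      unfolding that by simp
    finally show ?thesis .
  qed
  show "x = - 1 / (s - t) * (b - c)" "y = - 1 / (s - t) * (s * b - t * c)"
    by (rule solve[OF x], rule solve[OF y'])
qed

text \<open>Multiplying the first relation by \<open>U\<close> and the second by \<open>L\<close> evaluates \<open>L A U\<close> in two ways;
  entry by entry this is a regular linear system of two equations for \<open>L U\<close> and \<open>L A U\<close>.\<close>

lemma loewner_solution:
  fixes A B C L U :: "'a :: field mat"
  assumes A: "A \<in> carrier_mat n n" and B: "B \<in> carrier_mat n m" and C: "C \<in> carrier_mat p n"
    and L: "L \<in> carrier_mat p n" and U: "U \<in> carrier_mat n m"
    and LA: "L * A = s \<cdot>\<^sub>m L - C" and AU: "A * U = t \<cdot>\<^sub>m U - B" and st: "s \<noteq> t"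
  shows "L * U = (- 1 / (s - t)) \<cdot>\<^sub>m (L * B - C * U)"
    and "L * A * U = (- 1 / (s - t)) \<cdot>\<^sub>m (s \<cdot>\<^sub>m (L * B) - t \<cdot>\<^sub>m (C * U))"
proof -
  have 1: "L * A * U = s \<cdot>\<^sub>m (L * U) - C * U"
    unfolding LA by (rule smult_minus_mult[OF L C U])
  have "L * A * U = L * (A * U)"
    using L A U by simp
  also have "\<dots> = t \<cdot>\<^sub>m (L * U) - L * B"
    unfolding AU by (rule mult_smult_minus[OF L U B])
  finally have 2: "L * A * U = t \<cdot>\<^sub>m (L * U) - L * B" .
  have dims: "L * U \<in> carrier_mat p m" "L * B \<in> carrier_mat p m" "C * U \<in> carrier_mat p m"
    "L * A * U \<in> carrier_mat p m"
    using A B C L U by auto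
  have entries: "(L * U) $$ (i, j) = - 1 / (s - t) * ((L * B) $$ (i, j) - (C * U) $$ (i, j))"
    "(L * A * U) $$ (i, j)
       = - 1 / (s - t) * (s * (L * B) $$ (i, j) - t * (C * U) $$ (i, j))"
    if ij: "i < p" "j < m" for i j
  proof -
    have entry: "(c \<cdot>\<^sub>m X - Y) $$ (i, j) = c * X $$ (i, j) - Y $$ (i, j)"
      if "X \<in> carrier_mat p m" "Y \<in> carrier_mat p m" for c :: 'a and X Y
      using ij that by auto
    have x: "(L * A * U) $$ (i, j) = s * (L * U) $$ (i, j) - (C * U) $$ (i, j)"
      unfolding 1 by (rule entry[OF dims(1,3)])
    have y: "(L * A * U) $$ (i, j) = t * (L * U) $$ (i, j) - (L * B) $$ (i, j)"
      unfolding 2 by (rule entry[OF dims(1,2)])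
    show "(L * U) $$ (i, j) = - 1 / (s - t) * ((L * B) $$ (i, j) - (C * U) $$ (i, j))"
      "(L * A * U) $$ (i, j)
       = - 1 / (s - t) * (s * (L * B) $$ (i, j) - t * (C * U) $$ (i, j))"
      by (rule linear_system_solution[OF st x y])+
  qed
  show "L * U = (- 1 / (s - t)) \<cdot>\<^sub>m (L * B - C * U)"
    by (intro eq_matI) (simp_all add: entries L[THEN carrier_matD(1)] B[THEN carrier_matD(2)]
        C[THEN carrier_matD(1)] U[THEN carrier_matD(2)] del: index_mult_mat(1))
  show "L * A * U = (- 1 / (s - t)) \<cdot>\<^sub>m (s \<cdot>\<^sub>m (L * B) - t \<cdot>\<^sub>m (C * U))"
    by (intro eq_matI) (simp_all add: entries L[THEN carrier_matD(1)] B[THEN carrier_matD(2)]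
        C[THEN carrier_matD(1)] U[THEN carrier_matD(2)] del: index_mult_mat(1))
qed

text \<open>The case \<open>L = C (s I - A)\<^sup>-\<^sup>1\<close> and \<open>U = (t I - A)\<^sup>-\<^sup>1 B\<close>, for which \<open>L B\<close> and \<open>C U\<close> are values of
  the transfer function.\<close>

lemma resolvent_product_divided_difference:
  assumes A: "A \<in> carrier_mat n n" and B: "B \<in> carrier_mat n m" and C: "C \<in> carrier_mat p n"
    and s: "\<not> eigenvalue (cmat A) s" and t: "\<not> eigenvalue (cmat A) t" and st: "s \<noteq> t"
  defines "L \<equiv> cmat C * resolvent A s" and "U \<equiv> resolvent A t * cmat B"
    and "G \<equiv> transfer_fun A B C"
  shows "L * U = (- 1 / (s - t)) \<cdot>\<^sub>m (G s - G t)"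
    and "L * cmat A * U = (- 1 / (s - t)) \<cdot>\<^sub>m (s \<cdot>\<^sub>m G s - t \<cdot>\<^sub>m G t)"
proof -
  have cA: "cmat A \<in> carrier_mat n n" and cB: "cmat B \<in> carrier_mat n m"
    and cC: "cmat C \<in> carrier_mat p n"
    using A B C by auto
  note Rs = resolvent_inverts(1)[OF A s] and Rt = resolvent_inverts(1)[OF A t]
  have L: "L \<in> carrier_mat p n" and U: "U \<in> carrier_mat n m"
    using cB cC Rs Rt by (auto simp: L_def U_def)
  have LA: "L * cmat A = s \<cdot>\<^sub>m L - cmat C"
    using cC unfolding L_def assoc_mult_mat[OF cC Rs cA] state_mult_resolvent(2)[OF A s]
      mult_smult_minus[OF cC Rs one_carrier_mat] by simp
  have "cmat A * U = cmat A * resolvent A t * cmat B"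
    using cA cB Rt by (simp add: U_def assoc_mult_mat[of _ n n _ n])
  also have "\<dots> = t \<cdot>\<^sub>m U - cmat B"
    using cB unfolding U_def state_mult_resolvent(1)[OF A t]
      smult_minus_mult[OF Rt one_carrier_mat cB] by simp
  finally have AU: "cmat A * U = t \<cdot>\<^sub>m U - cmat B" .
  have G: "L * cmat B = G s" "cmat C * U = G t"
    using cB cC Rt by (auto simp: L_def U_def G_def transfer_fun_def assoc_mult_mat[of _ p n _ n])
  show "L * U = (- 1 / (s - t)) \<cdot>\<^sub>m (G s - G t)"
    and "L * cmat A * U = (- 1 / (s - t)) \<cdot>\<^sub>m (s \<cdot>\<^sub>m G s - t \<cdot>\<^sub>m G t)"
    using loewner_solution[OF cA cB cC L U LA AU st] by (simp_all add: G)
qed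

theorem theorem1:
  fixes n m p mx py J K :: nat
    and A B C BX CY :: "real mat"
    and G\<sigma>A GB GC :: "complex \<Rightarrow> complex mat"
    and \<rho> \<zeta> \<phi> \<omega> :: "nat \<Rightarrow> real"
    and UX LY LL MM HH GG :: "complex mat"
  assumes A: "A \<in> carrier_mat n n" "hurwitz A"
    and B: "B \<in> carrier_mat n m"
    and C: "C \<in> carrier_mat p n"
    and BX: "BX \<in> carrier_mat n mx"
    and CY: "CY \<in> carrier_mat py n"
    and G\<sigma>A: "G\<sigma>A = transfer_fun A BX CY"
    and GB: "GB = transfer_fun A B CY"
    and GC: "GC = transfer_fun A BX C"
    and nodes: "\<And>k j. k < K \<Longrightarrow> j < J \<Longrightarrow> \<omega> k \<noteq> \<zeta> j"
    and UX: "UX \<in> carrier_mat n (mx * J)"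
      "\<And>j. j < J \<Longrightarrow> col_block mx UX j =
         complex_of_real (\<rho> j) \<cdot>\<^sub>m (resolvent A (\<i> * complex_of_real (\<zeta> j)) * cmat BX)"
    and LY: "LY \<in> carrier_mat n (py * K)"
      "\<And>k. k < K \<Longrightarrow> row_block py (mat_adjoint LY) k =
         complex_of_real (\<phi> k) \<cdot>\<^sub>m (cmat CY * resolvent A (\<i> * complex_of_real (\<omega> k)))"
    and LL: "LL = mat_adjoint LY * UX"
    and MM: "MM = mat_adjoint LY * cmat A * UX"
    and HH: "HH = mat_adjoint LY * cmat B"
    and GG: "GG = cmat C * UX"
  shows "(\<forall>k<K. \<forall>j<J.
            mat_block py mx LL k j =
              (- (complex_of_real (\<phi> k) * complex_of_real (\<rho> j))
                 / (\<i> * complex_of_real (\<omega> k) - \<i> * complex_of_real (\<zeta> j))) \<cdot>\<^sub>m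
              (G\<sigma>A (\<i> * complex_of_real (\<omega> k)) - G\<sigma>A (\<i> * complex_of_real (\<zeta> j))) \<and>
            mat_block py mx MM k j =
              (- (complex_of_real (\<phi> k) * complex_of_real (\<rho> j))
                 / (\<i> * complex_of_real (\<omega> k) - \<i> * complex_of_real (\<zeta> j))) \<cdot>\<^sub>m
              ((\<i> * complex_of_real (\<omega> k)) \<cdot>\<^sub>m G\<sigma>A (\<i> * complex_of_real (\<omega> k))
                - (\<i> * complex_of_real (\<zeta> j)) \<cdot>\<^sub>m G\<sigma>A (\<i> * complex_of_real (\<zeta> j)))) \<and>
         (\<forall>k<K. row_block py HH k = complex_of_real (\<phi> k) \<cdot>\<^sub>m GB (\<i> * complex_of_real (\<omega> k))) \<and>
         (\<forall>j<J. col_block mx GG j = complex_of_real (\<rho> j) \<cdot>\<^sub>m GC (\<i> * complex_of_real (\<zeta> j)))"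
proof (intro conjI allI impI)
  have cA: "cmat A \<in> carrier_mat n n" and cB: "cmat B \<in> carrier_mat n m"
    and cC: "cmat C \<in> carrier_mat p n" and cBX: "cmat BX \<in> carrier_mat n mx"
    and cCY: "cmat CY \<in> carrier_mat py n"
    using A(1) B C BX CY by auto
  have R: "resolvent A (\<i> * complex_of_real w) \<in> carrier_mat n n" for w
    using resolvent_inverts(1)[OF A(1) hurwitz_imaginary_not_eigenvalue[OF A(2)]] .
  have LH: "mat_adjoint LY \<in> carrier_mat (py * K) n"
    using LY(1) by (intro carrier_matI) (auto simp: mat_adjoint_def)
  {
    fix k j assume k: "k < K" and j: "j < J"
    let ?s = "\<i> * complex_of_real (\<omega> k)" and ?t = "\<i> * complex_of_real (\<zeta> j)"
    let ?f = "complex_of_real (\<phi> k)" and ?r = "complex_of_real (\<rho> j)"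
    let ?L = "cmat CY * resolvent A ?s" and ?U = "resolvent A ?t * cmat BX"
    have st: "?s \<noteq> ?t"
      using nodes[OF k j] by simp
    note dd = resolvent_product_divided_difference[OF A(1) BX CY
        hurwitz_imaginary_not_eigenvalue[OF A(2)] hurwitz_imaginary_not_eigenvalue[OF A(2)] st,
        folded G\<sigma>A]
    have L: "?L \<in> carrier_mat py n" and U: "?U \<in> carrier_mat n mx"
      using mult_carrier_mat[OF cCY R] mult_carrier_mat[OF R cBX] .
    have weights: "(?f \<cdot>\<^sub>m X) * (?r \<cdot>\<^sub>m ?U) = (?f * ?r) \<cdot>\<^sub>m (X * ?U)" if "X \<in> carrier_mat py n" for X
      unfolding mult_smult_assoc_mat[OF that smult_carrier_mat[OF U]] mult_smult_distrib[OF that U]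
        smult_smult_mat ..
    have "mat_block py mx LL k j = (?f * ?r) \<cdot>\<^sub>m (?L * ?U)"
      unfolding LL mat_block_mult[OF LH UX(1) k j] LY(2)[OF k] UX(2)[OF j] by (rule weights[OF L])
    then show "mat_block py mx LL k j = (- (?f * ?r) / (?s - ?t)) \<cdot>\<^sub>m (G\<sigma>A ?s - G\<sigma>A ?t)"
      unfolding dd(1) smult_smult_mat by simp
    have "mat_block py mx MM k j = (?f \<cdot>\<^sub>m ?L) * cmat A * (?r \<cdot>\<^sub>m ?U)"
      unfolding MM mat_block_mult[OF mult_carrier_mat[OF LH cA] UX(1) k j]
        row_block_mult[OF LH cA k] LY(2)[OF k] UX(2)[OF j] ..
    also have "\<dots> = (?f \<cdot>\<^sub>m (?L * cmat A)) * (?r \<cdot>\<^sub>m ?U)"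
      using mult_smult_assoc_mat[OF L cA] by simp
    also have "\<dots> = (?f * ?r) \<cdot>\<^sub>m (?L * cmat A * ?U)"
      using weights[of "?L * cmat A"] L cA by simp
    finally show "mat_block py mx MM k j
        = (- (?f * ?r) / (?s - ?t)) \<cdot>\<^sub>m (?s \<cdot>\<^sub>m G\<sigma>A ?s - ?t \<cdot>\<^sub>m G\<sigma>A ?t)"
      unfolding dd(2) smult_smult_mat by simp
  }
  show "row_block py HH k = complex_of_real (\<phi> k) \<cdot>\<^sub>m GB (\<i> * complex_of_real (\<omega> k))"
    if k: "k < K" for k
    unfolding HH row_block_mult[OF LH cB k] LY(2)[OF k] GB transfer_fun_def
    by (rule mult_smult_assoc_mat[OF mult_carrier_mat[OF cCY R] cB])
  show "col_block mx GG j = complex_of_real (\<rho> j) \<cdot>\<^sub>m GC (\<i> * complex_of_real (\<zeta> j))"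
    if j: "j < J" for j
    unfolding GG col_block_mult[OF cC UX(1) j] UX(2)[OF j] GC transfer_fun_def
      mult_smult_distrib[OF cC mult_carrier_mat[OF R cBX]] assoc_mult_mat[OF cC R cBX] ..
qed

end
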